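(* Let $f_1,f_2,\ldots,f_n$ be a sequence of homogeneous polynomials of degrees $1\leq a_1\leq a_2\leq\cdots\leq a_n$ (with $f_i$ of degree $a_i$) in $S=\mathbb{C}[x_1,x_2,\ldots,x_n]$. If $\mathrm{d}(f_i,x_i^{a_i})<1$ for all $i=1,2,\ldots,n$, then $f_1,f_2,\ldots,f_n$ is a regular sequence in $S$.
   Context: Distance: for two homogeneous polynomials $f,g\in\mathbb{C}[x_1,\ldots,x_n]$ of the same degree $d$, write $f=\lambda_1x_1^d+\lambda_2x_1^{d-1}x_2+\cdots+\lambda_rx_n^d$ and $g=\nu_1x_1^d+\nu_2x_1^{d-1}x_2+\cdots+\nu_rx_n^d$ in terms of all $r=\binom{n+d-1}{d}$ monomials of degree $d$. Then the distance between $f$ and $g$ is $\mathrm{d}(f,g)=|\lambda_1-\nu_1|+|\lambda_2-\nu_2|+\cdots+|\lambda_r-\nu_r|$, i.e. the sum of absolute values of the coefficients of $f-g$. A sequence $f_1,\ldots,f_n$ in a commutative ring $S$ is a regular sequence if $(f_1,\ldots,f_n)\neq S$ and, for each $i=1,\ldots,n$, the element $f_i$ is a non-zero-divisor on $S/(f_1,\ldots,f_{i-1})$. *)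

theory Defs
  imports Complex_Main "HOL-Library.Poly_Mapping" "HOL-Algebra.QuotRing"
begin

text \<open>A monomial is a finitely supported map from variable indices to exponents, and a polynomial
  a finitely supported map from monomials to coefficients.  The type itself allows infinitely many
  variables; the carrier of \<open>poly_ring n\<close> cuts out those polynomials that only involve
  \<open>x\<^sub>1, \<dots>, x\<^sub>n\<close>.\<close>

type_synonym monomial = "nat \<Rightarrow>\<^sub>0 nat"
type_synonym cpoly = "monomial \<Rightarrow>\<^sub>0 complex"

definition poly_ring :: "nat \<Rightarrow> cpoly ring" where
  "poly_ring n =
     \<lparr>carrier = {p. \<forall>m \<in> Poly_Mapping.keys p. Poly_Mapping.keys m \<subseteq> {1..n}},
      mult = (*), one = 1, zero = 0, add = (+)\<rparr>"

definition X :: "nat \<Rightarrow> cpoly" where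
  "X i = Poly_Mapping.single (Poly_Mapping.single i 1) 1"

definition mdeg :: "monomial \<Rightarrow> nat" where
  "mdeg m = (\<Sum>i \<in> Poly_Mapping.keys m. Poly_Mapping.lookup m i)"

text \<open>The zero polynomial is homogeneous of every degree.\<close>

definition homogeneous :: "nat \<Rightarrow> cpoly \<Rightarrow> bool" where
  "homogeneous d p \<longleftrightarrow> (\<forall>m \<in> Poly_Mapping.keys p. mdeg m = d)"

definition monomials :: "nat \<Rightarrow> nat \<Rightarrow> monomial set" where
  "monomials n d = {m. Poly_Mapping.keys m \<subseteq> {1..n} \<and> mdeg m = d}"

definition poly_dist :: "nat \<Rightarrow> nat \<Rightarrow> cpoly \<Rightarrow> cpoly \<Rightarrow> real" where
  "poly_dist n d f g =
     (\<Sum>m \<in> monomials n d. cmod (Poly_Mapping.lookup f m - Poly_Mapping.lookup g m))"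

definition non_zero_divisor :: "('a, 'b) ring_scheme \<Rightarrow> 'a \<Rightarrow> bool" where
  "non_zero_divisor R a \<longleftrightarrow>
     a \<in> carrier R \<and> (\<forall>b \<in> carrier R. a \<otimes>\<^bsub>R\<^esub> b = \<zero>\<^bsub>R\<^esub> \<longrightarrow> b = \<zero>\<^bsub>R\<^esub>)"

text \<open>The sequence is \<open>f 1, \<dots>, f n\<close>; the coset \<open>I +> f i\<close> is the class of \<open>f i\<close> in \<open>R / I\<close>.\<close>

definition regular_sequence :: "('a, 'b) ring_scheme \<Rightarrow> nat \<Rightarrow> (nat \<Rightarrow> 'a) \<Rightarrow> bool" where
  "regular_sequence R n f \<longleftrightarrow>
     (\<forall>i \<in> {1..n}. f i \<in> carrier R) \<and>
     Idl\<^bsub>R\<^esub> (f ` {1..n}) \<noteq> carrier R \<and>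
     (\<forall>i \<in> {1..n}. non_zero_divisor (R Quot (Idl\<^bsub>R\<^esub> (f ` {1..<i})))
                                 (Idl\<^bsub>R\<^esub> (f ` {1..<i}) +>\<^bsub>R\<^esub> f i))"

text \<open>Well-formedness: \<open>poly_ring n\<close> is a commutative ring containing \<open>x\<^sub>1, \<dots>, x\<^sub>n\<close>, and the sum
  in \<open>poly_dist\<close> ranges over a finite set.\<close>

lemma cring_poly_ring: "cring (poly_ring n)"
proof (intro cringI abelian_groupI comm_monoidI)
  fix x y assume x: "x \<in> carrier (poly_ring n)" and y: "y \<in> carrier (poly_ring n)"
  show "x \<oplus>\<^bsub>poly_ring n\<^esub> y \<in> carrier (poly_ring n)"
    using x y Poly_Mapping.keys_add[of x y] by (auto simp: poly_ring_def)
  show "x \<otimes>\<^bsub>poly_ring n\<^esub> y \<in> carrier (poly_ring n)"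
  proof -
    have "Poly_Mapping.keys m \<subseteq> {1..n}" if m: "m \<in> Poly_Mapping.keys (x * y)" for m
    proof -
      obtain a b where "m = a + b" "a \<in> Poly_Mapping.keys x" "b \<in> Poly_Mapping.keys y"
        using Poly_Mapping.keys_mult[of x y] m by blast
      then show ?thesis
        using x y Poly_Mapping.keys_add[of a b] by (auto simp: poly_ring_def dest!: subsetD)
    qed
    then show ?thesis by (simp add: poly_ring_def)
  qed
  have "- x \<in> carrier (poly_ring n)"
    using x by (auto simp: poly_ring_def in_keys_iff)
  then show "\<exists>z \<in> carrier (poly_ring n). z \<oplus>\<^bsub>poly_ring n\<^esub> x = \<zero>\<^bsub>poly_ring n\<^esub>"
    by (rule rev_bexI) (simp add: poly_ring_def)
qed (auto simp: poly_ring_def algebra_simps)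

lemma X_in_carrier: "i \<in> {1..n} \<Longrightarrow> X i \<in> carrier (poly_ring n)"
  by (simp add: X_def poly_ring_def)

lemma finite_monomials: "finite (monomials n d)"
proof -
  have "Poly_Mapping.lookup m i \<le> mdeg m" for m i
    unfolding mdeg_def
    by (cases "i \<in> Poly_Mapping.keys m") (auto intro!: member_le_sum simp: in_keys_iff)
  then have "Poly_Mapping.lookup ` monomials n d \<subseteq>
      {g. (\<forall>i \<in> {1..n}. g i \<in> {..d}) \<and> (\<forall>i. i \<notin> {1..n} \<longrightarrow> g i = 0)}"
    by (fastforce simp: monomials_def in_keys_iff)
  moreover have "finite {g :: nat \<Rightarrow> nat. (\<forall>i \<in> {1..n}. g i \<in> {..d}) \<and> (\<forall>i. i \<notin> {1..n} \<longrightarrow> g i = 0)}"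
    using finite_set_of_finite_funs[of "{1..n}" "{..d}" "0::nat"]
    by (rule rev_finite_subset) auto
  ultimately have "finite (Poly_Mapping.lookup ` monomials n d)"
    by (rule finite_subset)
  then show ?thesis
    by (rule finite_imageD) (simp add: inj_on_def poly_mapping_eqI)
qed

end

theory Submission
  imports Defs
begin

text \<open>
  The powers \<open>x\<^sub>1\<^bsup>a\<^sub>1\<^esup>, \<dots>, x\<^sub>n\<^bsup>a\<^sub>n\<^esup>\<close> form a regular sequence for a reason that is
  visible on monomials. The idea is to find a linear bijection of \<open>S\<close>, called \<open>twist\<close> below,
  that turns multiplication by \<open>x\<^sub>i\<^bsup>a\<^sub>i\<^esup>\<close> into multiplication by \<open>f\<^sub>i\<close>, and to transport
  regularity along it. Writing each exponent as \<open>m\<^sub>i = a\<^sub>i q\<^sub>i + r\<^sub>i\<close> with \<open>r\<^sub>i < a\<^sub>i\<close>,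
  the map sends \<open>x\<^sup>m\<close> to \<open>\<Prod>\<^sub>i f\<^sub>i\<^bsup>q\<^sub>i\<^esup> x\<^sub>i\<^bsup>r\<^sub>i\<^esup>\<close>. That it is bijective says that \<open>S\<close> is free over
  \<open>\<complex>[f\<^sub>1, \<dots>, f\<^sub>n]\<close>, on the monomials whose exponents are all below the \<open>a\<^sub>i\<close>.

  Surjectivity (\<open>mono_poly_in_span\<close>) is where the distance enters. Write
  \<open>f\<^sub>i = x\<^sub>i\<^bsup>a\<^sub>i\<^esup> - h\<^sub>i\<close>, so that the coefficients of \<open>h\<^sub>i\<close> have absolute sum below 1.
  If the images of the monomials of degree \<open>d\<close> failed to span that degree, a nonzero linear
  functional would vanish on all of them. Choose a monomial \<open>x\<^sup>g\<close> of degree \<open>d\<close> where the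
  functional is largest in absolute value. Some \<open>g\<^sub>i\<close> is at least \<open>a\<^sub>i\<close>, as otherwise \<open>x\<^sup>g\<close>
  is its own image, and then \<open>x\<^sup>g = f\<^sub>i x\<^sup>k + h\<^sub>i x\<^sup>k\<close> with \<open>k\<close> of smaller degree. The first
  term is in the span by induction on the degree. The second is a combination of monomials of
  degree \<open>d\<close> with coefficients of absolute sum below 1, so the functional is smaller on it than
  the assumed maximum, a contradiction.

  Injectivity (\<open>twist_eq_0\<close>) is then a count: in each degree there are as many images as
  monomials, so a spanning family of images is a basis.

  Finally, the image of the monomial ideal generated by the \<open>x\<^sub>j\<^bsup>a\<^sub>j\<^esup>\<close> with \<open>j \<in> J\<close> is the
  ideal generated by the \<open>f\<^sub>j\<close> with \<open>j \<in> J\<close> (\<open>genideal_eq_twist\<close>). So both requirements of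
  regularity become statements about exponents: 1 is not divisible by any \<open>x\<^sub>j\<^bsup>a\<^sub>j\<^esup>\<close>, and
  multiplying by \<open>x\<^sub>i\<^bsup>a\<^sub>i\<^esup>\<close> does not change the exponent of any other variable.
\<close>

section \<open>Linear algebra\<close>

context vector_space
begin

text \<open>A basis of the span of \<open>W\<close> remains independent when \<open>x\<close> is added to it; the functional
  is the coordinate along \<open>x\<close> in a basis of the whole space that extends both.\<close>

lemma separating_functional:
  assumes "x \<notin> span W"
  obtains l where "\<And>u v. l (u + v) = l u + l v" "\<And>c u. l (c *s u) = c * l u"
    "\<And>w. w \<in> span W \<Longrightarrow> l w = 0" "l x \<noteq> 0"
proof -
  obtain B where B: "B \<subseteq> W" "independent B" "W \<subseteq> span B"
    using maximal_independent_subset by blast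
  have sp: "span W = span B"
    using B by (metis span_mono span_span subset_antisym)
  have "independent (insert x B)"
    using assms sp B(2) independent_insertI by metis
  then obtain C where C: "insert x B \<subseteq> C" "independent C" "UNIV \<subseteq> span C"
    using maximal_independent_subset_extend[of "insert x B" UNIV] by auto
  have xB: "x \<notin> B" using assms sp span_base by auto
  show ?thesis
  proof (rule that[of "\<lambda>u. representation C u x"])
    show "representation C (u + v) x = representation C u x + representation C v x" for u v
      using C by (subst representation_add) auto
    show "representation C (c *s u) x = c * representation C u x" for c u
      using C by (subst representation_scale) auto
    show "representation C w x = 0" if "w \<in> span W" for w
    proof -
      have "representation C w = representation B w"
        using C that sp by (intro representation_extend) auto
      then show ?thesis using xB representation_ne_zero by metis
    qed
    show "representation C x x \<noteq> 0"
      using C by (simp add: representation_basis)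
  qed
qed

text \<open>A family \<open>g\<close> with the same finite index set as an independent family \<open>e\<close> has no room for
  redundancy if it spans \<open>e\<close>: by the exchange lemma no smaller set spans \<open>e\<close>.\<close>

lemma spanning_family_independent:
  assumes "finite U" "inj_on e U" "independent (e ` U)" "e ` U \<subseteq> span (g ` U)"
  shows "inj_on g U" "independent (g ` U)"
proof -
  have le: "card U \<le> card T" if "finite T" "e ` U \<subseteq> span T" for T
    using independent_span_bound[OF that(1) assms(3) that(2)] card_image[OF assms(2)] by simp
  have "card (g ` U) = card U"
    using le[of "g ` U"] assms card_image_le[of U g] by auto
  then show "inj_on g U" using eq_card_imp_inj_on assms(1) by blast
  show "independent (g ` U)"
  proof
    assume "dependent (g ` U)"
    then obtain y where y: "y \<in> g ` U" "y \<in> span (g ` U - {y})"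
      by (auto simp: dependent_def)
    have "span (g ` U) \<subseteq> span (g ` U - {y})"
      using y by (metis span_redundant insert_Diff order_refl)
    then have "card U \<le> card (g ` U - {y})"
      using assms by (intro le) auto
    moreover have "card (g ` U - {y}) < card (g ` U)"
      using y(1) assms(1) by (intro card_Diff1_less) auto
    ultimately show False
      using card_image_le[OF assms(1), of g] by simp
  qed
qed

end

section \<open>Polynomials as a vector space\<close>

abbreviation mono_poly :: "monomial \<Rightarrow> cpoly" where
  "mono_poly m \<equiv> Poly_Mapping.single m 1"

definition scale :: "complex \<Rightarrow> cpoly \<Rightarrow> cpoly" where
  "scale c p = Poly_Mapping.single 0 c * p"

interpretation poly_vs: vector_space scale
  by unfold_locales
    (auto simp: scale_def distrib_left distrib_right single_add mult.assoc[symmetric] mult_single)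

lemma scale_mult_left: "scale c p * q = scale c (p * q)"
  and scale_mult_right: "q * scale c p = scale c (q * p)"
  by (simp_all add: scale_def mult_ac)

lemma scale_mono_poly: "scale c (mono_poly m) = Poly_Mapping.single m c"
  by (simp add: scale_def mult_single)

lemma lookup_scale: "Poly_Mapping.lookup (scale c p) m = c * Poly_Mapping.lookup p m"
  by (simp add: scale_def mult_map_scale_conv_mult[symmetric] map.rep_eq when_def)

lemma sum_single_lookup:
  fixes p :: "'a \<Rightarrow>\<^sub>0 'b::comm_monoid_add"
  assumes "finite A" "Poly_Mapping.keys p \<subseteq> A"
  shows "(\<Sum>m\<in>A. Poly_Mapping.single m (Poly_Mapping.lookup p m)) = p"
proof (rule poly_mapping_eqI)
  fix k
  have "(\<Sum>m\<in>A. Poly_Mapping.lookup p m when m = k) = Poly_Mapping.lookup p k"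
    using assms by (auto simp: when_def in_keys_iff)
  then show "Poly_Mapping.lookup (\<Sum>m\<in>A. Poly_Mapping.single m (Poly_Mapping.lookup p m)) k
      = Poly_Mapping.lookup p k"
    by (simp add: lookup_sum lookup_single)
qed

lemma inj_mono_poly: "inj_on mono_poly U"
proof (rule inj_onI)
  fix m k :: monomial assume "mono_poly m = mono_poly k"
  then have "Poly_Mapping.keys (mono_poly m) = Poly_Mapping.keys (mono_poly k)" by simp
  then show "m = k" by simp
qed

lemma independent_mono_poly:
  assumes "finite U"
  shows "poly_vs.independent (mono_poly ` U)"
proof
  assume "poly_vs.dependent (mono_poly ` U)"
  then obtain u m where m: "m \<in> U" "u (mono_poly m) \<noteq> 0"
    and "(\<Sum>v\<in>mono_poly ` U. scale (u v) v) = 0"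
    using assms by (auto simp: poly_vs.dependent_finite)
  then have "(\<Sum>k\<in>U. Poly_Mapping.single k (u (mono_poly k))) = 0"
    by (simp add: sum.reindex[OF inj_mono_poly] scale_mono_poly)
  then have "Poly_Mapping.lookup (\<Sum>k\<in>U. Poly_Mapping.single k (u (mono_poly k))) m = 0"
    by simp
  then show False using m assms by (simp add: lookup_sum lookup_single when_def)
qed

lemma X_power: "X i ^ k = mono_poly (Poly_Mapping.single i k)"
  by (induction k) (simp_all add: X_def mult_single single_add[symmetric] add.commute)

lemma prod_X_power:
  assumes "Poly_Mapping.keys m \<subseteq> {1..n}"
  shows "(\<Prod>i\<in>{1..n}. X i ^ Poly_Mapping.lookup m i) = mono_poly m"
proof -
  have "(\<Prod>i\<in>A. mono_poly (g i)) = mono_poly (sum g A)" if "finite A" for A and g :: "nat \<Rightarrow> monomial"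
    using that by (induction A) (simp_all add: mult_single)
  then have "(\<Prod>i\<in>{1..n}. X i ^ Poly_Mapping.lookup m i) =
     mono_poly (\<Sum>i\<in>{1..n}. Poly_Mapping.single i (Poly_Mapping.lookup m i))"
    by (simp add: X_power)
  also have "(\<Sum>i\<in>{1..n}. Poly_Mapping.single i (Poly_Mapping.lookup m i)) = m"
    using assms by (intro sum_single_lookup) auto
  finally show ?thesis .
qed

lemma mdeg_sum:
  assumes "finite A" "Poly_Mapping.keys m \<subseteq> A"
  shows "mdeg m = (\<Sum>i\<in>A. Poly_Mapping.lookup m i)"
  unfolding mdeg_def using assms by (intro sum.mono_neutral_left) (auto simp: in_keys_iff)

lemma mdeg_add: "mdeg (m + k) = mdeg m + mdeg k"
proof -
  let ?A = "Poly_Mapping.keys m \<union> Poly_Mapping.keys k"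
  have "Poly_Mapping.keys (m + k) \<subseteq> ?A" by (rule keys_add)
  then show ?thesis
    by (simp add: mdeg_sum[of ?A] lookup_add sum.distrib)
qed

lemma mdeg_single: "mdeg (Poly_Mapping.single i k) = k"
  by (simp add: mdeg_def)

lemma monomials_add:
  "m \<in> monomials n d \<Longrightarrow> k \<in> monomials n e \<Longrightarrow> m + k \<in> monomials n (d + e)"
  using keys_add[of m k] by (auto simp: monomials_def mdeg_add)

lemma split_off_power:
  assumes "b \<le> Poly_Mapping.lookup m i"
  shows "m = Poly_Mapping.single i b + (m - Poly_Mapping.single i b :: monomial)"
  using assms by (intro poly_mapping_eqI) (auto simp: lookup_add lookup_minus lookup_single when_def)

lemma carrier_poly_ring_iff:
  "p \<in> carrier (poly_ring n) \<longleftrightarrow> (\<forall>m\<in>Poly_Mapping.keys p. Poly_Mapping.keys m \<subseteq> {1..n})"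
  by (simp add: poly_ring_def)

lemma poly_ring_simps:
  "x \<otimes>\<^bsub>poly_ring n\<^esub> y = x * y" "x \<oplus>\<^bsub>poly_ring n\<^esub> y = x + y"
  "\<one>\<^bsub>poly_ring n\<^esub> = 1" "\<zero>\<^bsub>poly_ring n\<^esub> = 0"
  by (simp_all add: poly_ring_def)

lemma poly_ring_closed:
  assumes "x \<in> carrier (poly_ring n)" "y \<in> carrier (poly_ring n)"
  shows "x + y \<in> carrier (poly_ring n)" "x * y \<in> carrier (poly_ring n)"
proof -
  interpret R: cring "poly_ring n" by (rule cring_poly_ring)
  show "x + y \<in> carrier (poly_ring n)" "x * y \<in> carrier (poly_ring n)"
    using R.a_closed[OF assms] R.m_closed[OF assms] by (simp_all add: poly_ring_simps)
qed

lemma scale_carrier: "p \<in> carrier (poly_ring n) \<Longrightarrow> scale c p \<in> carrier (poly_ring n)"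
  by (auto simp: carrier_poly_ring_iff in_keys_iff lookup_scale)

lemma carrier_subspace: "poly_vs.subspace (carrier (poly_ring n))"
  by (rule poly_vs.subspaceI)
    (auto simp: poly_ring_closed scale_carrier carrier_poly_ring_iff[of 0])

lemma one_carrier: "1 \<in> carrier (poly_ring n)"
  by (simp add: carrier_poly_ring_iff)

lemma poly_ring_prod:
  "(\<And>i. i \<in> A \<Longrightarrow> g i \<in> carrier (poly_ring n)) \<Longrightarrow> prod g A \<in> carrier (poly_ring n)"
  by (induction A rule: infinite_finite_induct)
     (auto simp: poly_ring_closed one_carrier)

lemma poly_ring_power: "p \<in> carrier (poly_ring n) \<Longrightarrow> p ^ k \<in> carrier (poly_ring n)"
  by (induction k) (auto simp: poly_ring_closed one_carrier)

definition lin_ext :: "(monomial \<Rightarrow> cpoly) \<Rightarrow> cpoly \<Rightarrow> cpoly" where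
  "lin_ext g p = (\<Sum>m\<in>Poly_Mapping.keys p. scale (Poly_Mapping.lookup p m) (g m))"

lemma lin_ext_superset:
  assumes "finite A" "Poly_Mapping.keys p \<subseteq> A"
  shows "lin_ext g p = (\<Sum>m\<in>A. scale (Poly_Mapping.lookup p m) (g m))"
  unfolding lin_ext_def using assms by (intro sum.mono_neutral_left) (auto simp: in_keys_iff)

lemma lin_ext_zero [simp]: "lin_ext g 0 = 0"
  by (simp add: lin_ext_def)

lemma lin_ext_add: "lin_ext g (p + q) = lin_ext g p + lin_ext g q"
proof -
  let ?A = "Poly_Mapping.keys p \<union> Poly_Mapping.keys q"
  have "Poly_Mapping.keys (p + q) \<subseteq> ?A" by (rule keys_add)
  then show ?thesis
    by (simp add: lin_ext_superset[of ?A] lookup_add sum.distrib poly_vs.scale_left_distrib)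
qed

lemma lin_ext_scale: "lin_ext g (scale c p) = scale c (lin_ext g p)"
proof -
  have "Poly_Mapping.keys (scale c p) \<subseteq> Poly_Mapping.keys p"
    by (auto simp: in_keys_iff lookup_scale)
  then show ?thesis
    by (simp add: lin_ext_superset[of "Poly_Mapping.keys p"] lookup_scale poly_vs.scale_sum_right)
qed

lemma lin_ext_mono_poly [simp]: "lin_ext g (mono_poly m) = g m"
  by (simp add: lin_ext_def)

lemma lin_ext_sum: "lin_ext g (sum h A) = (\<Sum>x\<in>A. lin_ext g (h x))"
  by (induction A rule: infinite_finite_induct) (simp_all add: lin_ext_add)

lemma lin_ext_id: "lin_ext mono_poly p = p"
  unfolding lin_ext_def scale_mono_poly by (rule sum_single_lookup) auto

lemma lin_ext_mult: "p * lin_ext g q = lin_ext (\<lambda>m. p * g m) q"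
  by (simp add: lin_ext_def sum_distrib_left scale_mult_right)

lemma lin_ext_lin_ext: "lin_ext g (lin_ext h p) = lin_ext (\<lambda>m. lin_ext g (h m)) p"
  unfolding lin_ext_def[of h] by (simp add: lin_ext_sum lin_ext_scale) (simp add: lin_ext_def)

lemma lin_ext_in_subspace:
  assumes "poly_vs.subspace V" "\<And>m. m \<in> Poly_Mapping.keys p \<Longrightarrow> g m \<in> V"
  shows "lin_ext g p \<in> V"
  unfolding lin_ext_def using assms
  by (intro poly_vs.subspace_sum poly_vs.subspace_scale) auto

text \<open>Multiplication by a monomial only shifts exponents, so coefficients can be read off.\<close>

lemma lookup_mono_poly_mult:
  "Poly_Mapping.lookup (mono_poly k * p) (k + m) = Poly_Mapping.lookup p m"
proof -
  have "mono_poly k * p = lin_ext (\<lambda>m. mono_poly (k + m)) p"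
    using lin_ext_mult[of "mono_poly k" mono_poly p] by (simp add: lin_ext_id mult_single)
  then show ?thesis
    by (auto simp: lin_ext_def scale_mono_poly lookup_sum lookup_single when_def in_keys_iff)
qed

section \<open>Polynomials near pure powers\<close>

locale near_pure_powers =
  fixes n :: nat and a :: "nat \<Rightarrow> nat" and f :: "nat \<Rightarrow> cpoly"
  assumes f_carrier: "i \<in> {1..n} \<Longrightarrow> f i \<in> carrier (poly_ring n)"
    and f_homogeneous: "i \<in> {1..n} \<Longrightarrow> homogeneous (a i) (f i)"
    and a_pos: "i \<in> {1..n} \<Longrightarrow> 1 \<le> a i"
    and f_near: "i \<in> {1..n} \<Longrightarrow> poly_dist n (a i) (f i) (X i ^ a i) < 1"
begin

text \<open>The exponents are divided by \<open>a\<close> with remainder; the quotients are then exponents of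
  the \<open>f i\<close>. With \<open>f i = X i ^ a i\<close> this would be the monomial itself.\<close>

definition twisted_mono :: "monomial \<Rightarrow> cpoly" where
  "twisted_mono m = (\<Prod>i\<in>{1..n}. f i ^ (Poly_Mapping.lookup m i div a i)
                                  * X i ^ (Poly_Mapping.lookup m i mod a i))"

abbreviation twist :: "cpoly \<Rightarrow> cpoly" where
  "twist \<equiv> lin_ext twisted_mono"

lemma twisted_mono_add:
  assumes i: "i \<in> {1..n}"
  shows "twisted_mono (Poly_Mapping.single i (a i) + m) = f i * twisted_mono m"
proof -
  have "twisted_mono (Poly_Mapping.single i (a i) + m) =
    (\<Prod>j\<in>{1..n}. (if j = i then f i else 1) * (f j ^ (Poly_Mapping.lookup m j div a j)
                                  * X j ^ (Poly_Mapping.lookup m j mod a j)))"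
    unfolding twisted_mono_def using a_pos[OF i]
    by (intro prod.cong) (auto simp: lookup_add lookup_single when_def mult.assoc)
  also have "\<dots> = f i * twisted_mono m"
    using i by (simp add: prod.distrib twisted_mono_def)
  finally show ?thesis .
qed

text \<open>This is the property for which \<open>twist\<close> was constructed. In general it is not a ring
  homomorphism, since a sum of two remainders may reach \<open>a i\<close>.\<close>

lemma twist_mult:
  assumes "i \<in> {1..n}"
  shows "twist (X i ^ a i * p) = f i * twist p"
proof -
  have "X i ^ a i * p = lin_ext (\<lambda>m. mono_poly (Poly_Mapping.single i (a i) + m)) p"
    using lin_ext_mult[of "X i ^ a i" mono_poly p] by (simp add: lin_ext_id X_power mult_single)
  then show ?thesis
    using assms by (simp add: lin_ext_lin_ext twisted_mono_add lin_ext_mult)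
qed

lemma twisted_mono_reduced:
  assumes "Poly_Mapping.keys m \<subseteq> {1..n}" "\<And>i. i \<in> {1..n} \<Longrightarrow> Poly_Mapping.lookup m i < a i"
  shows "twisted_mono m = mono_poly m"
  using assms by (simp add: twisted_mono_def flip: prod_X_power[OF assms(1)])

lemma twisted_mono_carrier: "twisted_mono m \<in> carrier (poly_ring n)"
  unfolding twisted_mono_def
  by (intro poly_ring_prod poly_ring_closed poly_ring_power f_carrier X_in_carrier)

lemma twist_carrier: "twist p \<in> carrier (poly_ring n)"
  by (rule lin_ext_in_subspace[OF carrier_subspace twisted_mono_carrier])

lemma twist_one: "twist 1 = 1"
  using lin_ext_mono_poly[of twisted_mono 0] by (simp add: twisted_mono_def)

text \<open>A functional that vanishes on the twisted monomials of degree \<open>d\<close> contradicts its own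
  maximality on the monomials of degree \<open>d\<close>, because replacing \<open>X i ^ a i\<close> by \<open>X i ^ a i - f i\<close> is
  a strict contraction in the coefficient sum norm. Staying within one degree matters
  twice: it leaves finitely many monomials to maximise over, and homogeneity of \<open>f i\<close> keeps
  the replacement inside that degree.\<close>

lemma mono_poly_in_span:
  "m \<in> monomials n d \<Longrightarrow> mono_poly m \<in> poly_vs.span (twisted_mono ` monomials n d)"
proof (induction d arbitrary: m rule: less_induct)
  case (less d)
  let ?S = "poly_vs.span (twisted_mono ` monomials n d)"
  show ?case
  proof (rule ccontr)
    assume "mono_poly m \<notin> ?S"
    then obtain l where l: "\<And>u v. l (u + v) = l u + l v" "\<And>c u. l (scale c u) = c * l u"
      "\<And>w. w \<in> ?S \<Longrightarrow> l w = 0" "l (mono_poly m) \<noteq> 0"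
      using poly_vs.separating_functional by (metis (no_types, lifting))
    have l_sum: "l (sum h A) = (\<Sum>x\<in>A. l (h x))" for h and A :: "monomial set"
      using l(1) l(3)[OF poly_vs.span_zero] by (induction A rule: infinite_finite_induct) auto
    define L where "L k = cmod (l (mono_poly k))" for k
    have fin: "finite (L ` monomials n d)" by (simp add: finite_monomials)
    have "Max (L ` monomials n d) \<in> L ` monomials n d"
      using fin less.prems by (intro Max_in) auto
    then obtain g where g: "g \<in> monomials n d" "L g = Max (L ` monomials n d)" by auto
    have L_le: "L k \<le> L g" if "k \<in> monomials n d" for k
      using that g fin by auto
    have "0 < L m" using l(4) by (simp add: L_def)
    then have L_pos: "0 < L g" using L_le[OF less.prems] by simp
    have "\<exists>i\<in>{1..n}. a i \<le> Poly_Mapping.lookup g i"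
    proof (rule ccontr)
      assume "\<not> ?thesis"
      then have "mono_poly g = twisted_mono g"
        using g by (subst twisted_mono_reduced) (auto simp: monomials_def not_le)
      then have "mono_poly g \<in> ?S" using g(1) by (simp add: poly_vs.span_base)
      then show False using l(3) L_pos by (simp add: L_def)
    qed
    then obtain i where i: "i \<in> {1..n}" "a i \<le> Poly_Mapping.lookup g i" by blast
    define k where "k = g - Poly_Mapping.single i (a i)"
    have gk: "g = Poly_Mapping.single i (a i) + k"
      unfolding k_def by (rule split_off_power[OF i(2)])
    have k: "k \<in> monomials n (d - a i)" "a i \<le> d"
    proof -
      have "mdeg g = a i + mdeg k" by (simp add: gk mdeg_add mdeg_single)
      moreover have "Poly_Mapping.keys k \<subseteq> Poly_Mapping.keys g"
        by (auto simp: k_def in_keys_iff lookup_minus)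
      ultimately show "k \<in> monomials n (d - a i)" "a i \<le> d"
        using g(1) by (auto simp: monomials_def)
    qed
    have "f i * mono_poly k \<in> ?S"
    proof -
      have sub: "poly_vs.subspace {p. f i * p \<in> ?S}"
        by (rule poly_vs.subspaceI)
          (auto simp: poly_vs.span_zero distrib_left scale_mult_right
            intro: poly_vs.span_add poly_vs.span_scale)
      have "f i * twisted_mono q \<in> ?S" if "q \<in> monomials n (d - a i)" for q
      proof -
        have "Poly_Mapping.single i (a i) \<in> monomials n (a i)"
          using i(1) by (auto simp: monomials_def mdeg_single)
        then have "Poly_Mapping.single i (a i) + q \<in> monomials n d"
          using monomials_add[OF _ that] k(2) by fastforce
        then show ?thesis
          using i(1) by (auto simp flip: twisted_mono_add intro: poly_vs.span_base)
      qed
      then have "poly_vs.span (twisted_mono ` monomials n (d - a i)) \<subseteq> {p. f i * p \<in> ?S}"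
        by (intro poly_vs.span_minimal sub) auto
      moreover have "mono_poly k \<in> poly_vs.span (twisted_mono ` monomials n (d - a i))"
        using k a_pos[OF i(1)] by (intro less.IH) auto
      ultimately show ?thesis by auto
    qed
    then have l_fk: "l (f i * mono_poly k) = 0" by (rule l(3))
    \<comment> \<open>The error term has the sign that gives \<open>X i ^ a i = f i + h\<close>.\<close>
    define h where "h = X i ^ a i - f i"
    have "Poly_Mapping.keys h \<subseteq> monomials n (a i)"
    proof -
      have "Poly_Mapping.keys (f i) \<subseteq> monomials n (a i)"
        using f_carrier[OF i(1)] f_homogeneous[OF i(1)]
        by (auto simp: monomials_def carrier_poly_ring_iff homogeneous_def)
      moreover have "Poly_Mapping.keys (X i ^ a i) \<subseteq> monomials n (a i)"
        using i(1) by (auto simp: X_power monomials_def mdeg_single)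
      moreover have "Poly_Mapping.keys h \<subseteq> Poly_Mapping.keys (X i ^ a i) \<union> Poly_Mapping.keys (f i)"
        by (auto simp: h_def in_keys_iff lookup_minus)
      ultimately show ?thesis by (meson Un_least order_trans)
    qed
    then have h: "h = (\<Sum>q\<in>monomials n (a i). scale (Poly_Mapping.lookup h q) (mono_poly q))"
      by (simp add: scale_mono_poly sum_single_lookup finite_monomials)
    have "mono_poly g = f i * mono_poly k + h * mono_poly k"
      by (simp add: h_def gk X_power mult_single algebra_simps)
    then have "l (mono_poly g) = l (h * mono_poly k)"
      using l(1) l_fk by simp
    also have "h * mono_poly k =
        (\<Sum>q\<in>monomials n (a i). scale (Poly_Mapping.lookup h q) (mono_poly (q + k)))"
      by (subst h) (simp add: sum_distrib_right scale_mult_left mult_single)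
    also have "l \<dots> = (\<Sum>q\<in>monomials n (a i). Poly_Mapping.lookup h q * l (mono_poly (q + k)))"
      by (simp add: l_sum l(2))
    finally have "L g \<le> (\<Sum>q\<in>monomials n (a i). cmod (Poly_Mapping.lookup h q) * L (q + k))"
      unfolding L_def by (metis (mono_tags, lifting) norm_mult norm_sum sum.cong)
    also have "\<dots> \<le> (\<Sum>q\<in>monomials n (a i). cmod (Poly_Mapping.lookup h q) * L g)"
    proof (intro sum_mono mult_left_mono L_le)
      fix q assume "q \<in> monomials n (a i)"
      from monomials_add[OF this k(1)] show "q + k \<in> monomials n d" using k(2) by simp
    qed auto
    also have "\<dots> = poly_dist n (a i) (f i) (X i ^ a i) * L g"
      by (simp add: poly_dist_def h_def lookup_minus norm_minus_commute sum_distrib_right)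
    also have "\<dots> < L g"
      using f_near[OF i(1)] L_pos by simp
    finally show False by simp
  qed
qed

lemma twist_surj:
  assumes "p \<in> carrier (poly_ring n)"
  obtains q where "q \<in> carrier (poly_ring n)" "p = twist q"
proof -
  let ?V = "twist ` carrier (poly_ring n)"
  have V: "poly_vs.subspace ?V"
  proof (rule poly_vs.subspaceI)
    show "0 \<in> ?V" by (rule image_eqI[of _ _ 0]) (auto simp: carrier_poly_ring_iff)
    show "x + y \<in> ?V" if "x \<in> ?V" "y \<in> ?V" for x y
      using that by (auto simp flip: lin_ext_add simp: poly_ring_closed)
    show "scale c x \<in> ?V" if "x \<in> ?V" for c x
      using that by (auto simp flip: lin_ext_scale simp: scale_carrier)
  qed
  have "mono_poly m \<in> ?V" if "m \<in> Poly_Mapping.keys p" for m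
  proof -
    have m: "m \<in> monomials n (mdeg m)"
      using assms that by (auto simp: monomials_def carrier_poly_ring_iff)
    have "twisted_mono k \<in> ?V" if "k \<in> monomials n d" for k d
      using that by (intro image_eqI[of _ _ "mono_poly k"])
        (auto simp: monomials_def carrier_poly_ring_iff)
    then have "poly_vs.span (twisted_mono ` monomials n (mdeg m)) \<subseteq> ?V"
      by (intro poly_vs.span_minimal V) auto
    then show ?thesis using mono_poly_in_span[OF m] by auto
  qed
  then have "lin_ext mono_poly p \<in> ?V" by (intro lin_ext_in_subspace V)
  then show ?thesis using that by (auto simp: lin_ext_id)
qed

text \<open>Only the finitely many degrees that occur in \<open>p\<close> are relevant; in these the twisted monomials
  span, and there are no more of them than monomials.\<close>

lemma twist_eq_0:
  assumes p: "p \<in> carrier (poly_ring n)" and "twist p = 0"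
  shows "p = 0"
proof -
  define U where "U = (\<Union>d\<in>mdeg ` Poly_Mapping.keys p. monomials n d)"
  have fin: "finite U" by (simp add: U_def finite_monomials)
  have keys: "Poly_Mapping.keys p \<subseteq> U"
    using p by (auto simp: U_def monomials_def carrier_poly_ring_iff)
  have "mono_poly m \<in> poly_vs.span (twisted_mono ` U)" if m: "m \<in> U" for m
  proof -
    obtain d where d: "m \<in> monomials n d" "d \<in> mdeg ` Poly_Mapping.keys p"
      using m unfolding U_def by blast
    then have "monomials n d \<subseteq> U" unfolding U_def by blast
    then show ?thesis
      using mono_poly_in_span[OF d(1)] poly_vs.span_mono[OF image_mono] by blast
  qed
  then have sp: "mono_poly ` U \<subseteq> poly_vs.span (twisted_mono ` U)" by auto
  note * = poly_vs.spanning_family_independent[OF fin inj_mono_poly independent_mono_poly[OF fin] sp]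
  \<comment> \<open>Injectivity allows the coefficients of \<open>p\<close> to be indexed by the twisted monomials.\<close>
  let ?u = "\<lambda>v. Poly_Mapping.lookup p (the_inv_into U twisted_mono v)"
  have "(\<Sum>v\<in>twisted_mono ` U. scale (?u v) v)
      = (\<Sum>m\<in>U. scale (Poly_Mapping.lookup p m) (twisted_mono m))"
    by (simp add: sum.reindex[OF *(1)] the_inv_into_f_f[OF *(1)])
  also have "\<dots> = 0"
    using assms(2) by (simp add: lin_ext_superset[OF fin keys])
  finally have "\<forall>v\<in>twisted_mono ` U. ?u v = 0"
    using *(2) fin by (auto simp: poly_vs.dependent_finite)
  then have "\<forall>m\<in>U. Poly_Mapping.lookup p m = 0"
    by (simp add: the_inv_into_f_f[OF *(1)])
  then show ?thesis using keys by (metis in_keys_iff keys_eq_empty subset_iff ex_in_conv)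
qed

lemma twist_inj:
  assumes "p \<in> carrier (poly_ring n)" "q \<in> carrier (poly_ring n)" "twist p = twist q"
  shows "p = q"
proof -
  have eq: "p - q = p + scale (-1) q" by simp
  have "twist (p - q) = 0" unfolding eq using assms(3) by (simp only: lin_ext_add lin_ext_scale) simp
  moreover have "p - q \<in> carrier (poly_ring n)"
    unfolding eq using assms by (intro poly_ring_closed scale_carrier)
  ultimately show ?thesis using twist_eq_0 by force
qed

section \<open>The ideals generated by the sequence\<close>

text \<open>The ideal generated by the \<open>X j ^ a j\<close> with \<open>j \<in> J\<close>, described by its monomials:
  a polynomial belongs to a monomial ideal exactly when each of its monomials does.\<close>

definition pure_power_ideal :: "nat set \<Rightarrow> cpoly set" where
  "pure_power_ideal J = {p \<in> carrier (poly_ring n).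
     \<forall>m\<in>Poly_Mapping.keys p. \<exists>j\<in>J. a j \<le> Poly_Mapping.lookup m j}"

lemma pure_power_ideal_subspace: "poly_vs.subspace (pure_power_ideal J)"
proof (rule poly_vs.subspaceI)
  show "x + y \<in> pure_power_ideal J" if "x \<in> pure_power_ideal J" "y \<in> pure_power_ideal J" for x y
    using that keys_add[of x y] poly_ring_closed by (fastforce simp: pure_power_ideal_def)
qed (auto simp: pure_power_ideal_def scale_carrier in_keys_iff lookup_scale carrier_poly_ring_iff)

lemma power_mult_in_pure_power_ideal:
  assumes "j \<in> J" "j \<in> {1..n}" "q \<in> carrier (poly_ring n)"
  shows "X j ^ a j * q \<in> pure_power_ideal J"
proof -
  have "a j \<le> Poly_Mapping.lookup m j" if "m \<in> Poly_Mapping.keys (X j ^ a j * q)" for m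
    using that keys_mult[of "X j ^ a j" q] by (auto simp: X_power lookup_add)
  moreover have "X j ^ a j * q \<in> carrier (poly_ring n)"
    using assms by (intro poly_ring_closed poly_ring_power X_in_carrier)
  ultimately show ?thesis using assms(1) by (auto simp: pure_power_ideal_def)
qed

text \<open>Since \<open>twist\<close> need not be multiplicative, absorption needs an argument. A twisted
  monomial in the image has a factor \<open>f j\<close>. The product of the cofactor with any \<open>s\<close> is again of
  the form \<open>twist q\<close> by surjectivity, and \<open>f j * twist q = twist (X j ^ a j * q)\<close>.\<close>

lemma twist_pure_power_ideal_is_ideal:
  assumes J: "J \<subseteq> {1..n}"
  shows "ideal (twist ` pure_power_ideal J) (poly_ring n)"
proof -
  interpret R: cring "poly_ring n" by (rule cring_poly_ring)
  let ?I = "twist ` pure_power_ideal J"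
  have V: "poly_vs.subspace ?I"
  proof (rule poly_vs.subspaceI)
    show "0 \<in> ?I" by (rule image_eqI[of _ _ 0])
        (auto simp: poly_vs.subspace_0[OF pure_power_ideal_subspace])
    show "x + y \<in> ?I" if "x \<in> ?I" "y \<in> ?I" for x y
      using that by (auto simp flip: lin_ext_add intro: poly_vs.subspace_add[OF pure_power_ideal_subspace])
    show "scale c x \<in> ?I" if "x \<in> ?I" for c x
      using that by (auto simp flip: lin_ext_scale intro: poly_vs.subspace_scale[OF pure_power_ideal_subspace])
  qed
  have absorb: "s * x \<in> ?I" if s: "s \<in> carrier (poly_ring n)" and x: "x \<in> ?I" for s x
  proof -
    obtain p where p: "p \<in> pure_power_ideal J" "x = twist p" using x by auto
    have "s * twisted_mono m \<in> ?I" if m: "m \<in> Poly_Mapping.keys p" for m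
    proof -
      obtain j where j: "j \<in> J" "a j \<le> Poly_Mapping.lookup m j"
        using p m by (auto simp: pure_power_ideal_def)
      let ?k = "m - Poly_Mapping.single j (a j)"
      obtain q where q: "q \<in> carrier (poly_ring n)" "s * twisted_mono ?k = twist q"
        using twist_surj[OF poly_ring_closed(2)[OF s twisted_mono_carrier]] by blast
      have "s * twisted_mono m = f j * (s * twisted_mono ?k)"
        using twisted_mono_add[of j ?k] j J split_off_power[OF j(2)] by (auto simp: mult_ac)
      also have "\<dots> = twist (X j ^ a j * q)"
        using j J by (simp add: q twist_mult subset_iff)
      finally show ?thesis
        using power_mult_in_pure_power_ideal[OF j(1) _ q(1)] j(1) J by auto
    qed
    then show ?thesis by (simp add: p lin_ext_mult lin_ext_in_subspace[OF V])
  qed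
  show ?thesis
  proof (rule idealI[OF R.ring_axioms])
    show "subgroup ?I (add_monoid (poly_ring n))"
    proof (rule R.add.subgroupI)
      show "?I \<subseteq> carrier (poly_ring n)" using twist_carrier by auto
      show "?I \<noteq> {}" using poly_vs.subspace_0[OF V] by blast
      show "x \<oplus>\<^bsub>poly_ring n\<^esub> y \<in> ?I" if "x \<in> ?I" "y \<in> ?I" for x y
        using poly_vs.subspace_add[OF V that] by (simp add: poly_ring_simps)
      show "\<ominus>\<^bsub>poly_ring n\<^esub> x \<in> ?I" if x: "x \<in> ?I" for x
      proof -
        have nx: "- x \<in> ?I" by (rule poly_vs.subspace_neg[OF V x])
        have "\<ominus>\<^bsub>poly_ring n\<^esub> x = - x"
          using x nx twist_carrier by (intro R.minus_equality) (auto simp: poly_ring_simps)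
        then show ?thesis using nx by simp
      qed
    qed
    show "x \<otimes>\<^bsub>poly_ring n\<^esub> i \<in> ?I" "i \<otimes>\<^bsub>poly_ring n\<^esub> x \<in> ?I"
      if "i \<in> ?I" "x \<in> carrier (poly_ring n)" for i x
      using absorb[OF that(2,1)] by (simp_all add: poly_ring_simps mult.commute)
  qed
qed

lemma genideal_eq_twist:
  assumes J: "J \<subseteq> {1..n}"
  shows "Idl\<^bsub>poly_ring n\<^esub> (f ` J) = twist ` pure_power_ideal J"
proof
  interpret R: cring "poly_ring n" by (rule cring_poly_ring)
  have fJ: "f ` J \<subseteq> carrier (poly_ring n)" using J f_carrier by auto
  interpret I: ideal "Idl\<^bsub>poly_ring n\<^esub> (f ` J)" "poly_ring n"
    by (rule R.genideal_ideal[OF fJ])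
  have "f j \<in> twist ` pure_power_ideal J" if j: "j \<in> J" for j
  proof -
    have jn: "j \<in> {1..n}" using j J by auto
    then have "f j = twist (X j ^ a j * 1)"
      by (simp only: twist_mult twist_one) simp
    then show ?thesis
      using power_mult_in_pure_power_ideal[OF j jn one_carrier] by (rule image_eqI)
  qed
  then show "Idl\<^bsub>poly_ring n\<^esub> (f ` J) \<subseteq> twist ` pure_power_ideal J"
    by (intro R.genideal_minimal twist_pure_power_ideal_is_ideal[OF J]) auto
  let ?I = "Idl\<^bsub>poly_ring n\<^esub> (f ` J)"
  have closed: "s * x \<in> ?I" if "s \<in> carrier (poly_ring n)" "x \<in> ?I" for s x
    using I.I_l_closed[OF that(2,1)] by (simp add: poly_ring_simps)
  have V: "poly_vs.subspace ?I"
  proof (rule poly_vs.subspaceI)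
    show "0 \<in> ?I" using I.zero_closed by (simp add: poly_ring_simps)
    show "x + y \<in> ?I" if "x \<in> ?I" "y \<in> ?I" for x y
      using I.a_closed[OF that] by (simp add: poly_ring_simps)
    show "scale c x \<in> ?I" if "x \<in> ?I" for c x
      unfolding scale_def by (rule closed[OF _ that]) (auto simp: carrier_poly_ring_iff)
  qed
  show "twist ` pure_power_ideal J \<subseteq> ?I"
  proof
    fix x assume "x \<in> twist ` pure_power_ideal J"
    then obtain p where p: "p \<in> pure_power_ideal J" "x = twist p" by auto
    have "twisted_mono m \<in> ?I" if m: "m \<in> Poly_Mapping.keys p" for m
    proof -
      obtain j where j: "j \<in> J" "a j \<le> Poly_Mapping.lookup m j"
        using p m by (auto simp: pure_power_ideal_def)
      let ?k = "m - Poly_Mapping.single j (a j)"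
      have "twisted_mono m = twisted_mono ?k * f j"
        using twisted_mono_add[of j ?k] j J split_off_power[OF j(2)] by (auto simp: mult_ac)
      moreover have "f j \<in> ?I" using R.genideal_self[OF fJ] j(1) by auto
      ultimately show ?thesis using closed[OF twisted_mono_carrier] by simp
    qed
    then show "x \<in> ?I" unfolding p(2) by (intro lin_ext_in_subspace[OF V])
  qed
qed

lemma one_notin_genideal: "1 \<notin> Idl\<^bsub>poly_ring n\<^esub> (f ` {1..n})"
proof
  assume "1 \<in> Idl\<^bsub>poly_ring n\<^esub> (f ` {1..n})"
  then obtain p where p: "p \<in> pure_power_ideal {1..n}" "twist p = 1"
    by (auto simp: genideal_eq_twist)
  have "p = 1"
  proof (rule twist_inj)
    show "p \<in> carrier (poly_ring n)" using p(1) by (simp add: pure_power_ideal_def)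
    show "twist p = twist 1" by (simp only: p(2) twist_one)
  qed (rule one_carrier)
  then show False
    using p(1) a_pos by (fastforce simp: pure_power_ideal_def)
qed

text \<open>Pulled back along the bijection \<open>twist\<close>, this is cancellation of \<open>X i ^ a i\<close> modulo an
  ideal generated by powers of other variables.\<close>

lemma mult_in_genideal_cancel:
  assumes J: "J \<subseteq> {1..n}" and i: "i \<in> {1..n}" "i \<notin> J"
    and b: "b \<in> carrier (poly_ring n)" and fb: "f i * b \<in> Idl\<^bsub>poly_ring n\<^esub> (f ` J)"
  shows "b \<in> Idl\<^bsub>poly_ring n\<^esub> (f ` J)"
proof -
  obtain q where q: "q \<in> carrier (poly_ring n)" "b = twist q" using twist_surj[OF b] .
  obtain p where p: "p \<in> pure_power_ideal J" "f i * b = twist p"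
    using fb by (auto simp: genideal_eq_twist[OF J])
  have eq: "X i ^ a i * q = p"
  proof (rule twist_inj)
    show "X i ^ a i * q \<in> carrier (poly_ring n)"
      by (intro poly_ring_closed poly_ring_power X_in_carrier i(1) q(1))
    show "p \<in> carrier (poly_ring n)" using p(1) by (simp add: pure_power_ideal_def)
    show "twist (X i ^ a i * q) = twist p"
      using twist_mult[OF i(1), of q] p(2) q(2) by simp
  qed
  have "\<exists>j\<in>J. a j \<le> Poly_Mapping.lookup m j" if "m \<in> Poly_Mapping.keys q" for m
  proof -
    have "Poly_Mapping.single i (a i) + m \<in> Poly_Mapping.keys p"
      using that by (simp add: eq[symmetric] X_power in_keys_iff lookup_mono_poly_mult)
    then obtain j where "j \<in> J" "a j \<le> Poly_Mapping.lookup (Poly_Mapping.single i (a i) + m) j"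
      using p(1) by (auto simp: pure_power_ideal_def)
    then show ?thesis
      using i(2) by (auto simp: lookup_add lookup_single when_def split: if_splits)
  qed
  then have "q \<in> pure_power_ideal J" using q(1) by (simp add: pure_power_ideal_def)
  then show ?thesis by (simp add: genideal_eq_twist[OF J] q(2))
qed

end

lemma (in ideal) non_zero_divisor_quotI:
  assumes x: "x \<in> carrier R" and cancel: "\<And>b. b \<in> carrier R \<Longrightarrow> x \<otimes> b \<in> I \<Longrightarrow> b \<in> I"
  shows "non_zero_divisor (R Quot I) (I +> x)"
  unfolding non_zero_divisor_def
proof (intro conjI ballI impI)
  show "I +> x \<in> carrier (R Quot I)" using x by (auto simp: FactRing_simps)
  fix c assume "c \<in> carrier (R Quot I)" and 0: "(I +> x) \<otimes>\<^bsub>R Quot I\<^esub> c = \<zero>\<^bsub>R Quot I\<^esub>"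
  then obtain b where b: "b \<in> carrier R" "c = I +> b" by (auto simp: FactRing_simps)
  have "I +> (x \<otimes> b) = I"
    using 0 by (simp add: b FactRing_def rcoset_mult_add[OF x b(1)])
  then have "x \<otimes> b \<in> I" using x b by (intro rcos_const_imp_mem) auto
  then have "b \<in> I" by (rule cancel[OF b(1)])
  then show "c = \<zero>\<^bsub>R Quot I\<^esub>" by (simp add: b FactRing_def a_rcos_const)
qed

theorem theorem3p5:
  fixes n :: nat and a :: "nat \<Rightarrow> nat" and f :: "nat \<Rightarrow> cpoly"
  assumes "\<forall>i \<in> {1..n}. f i \<in> carrier (poly_ring n)"
    and "\<forall>i \<in> {1..n}. homogeneous (a i) (f i)"
    and "\<forall>i \<in> {1..n}. 1 \<le> a i"
    and "mono_on {1..n} a"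
    and "\<forall>i \<in> {1..n}. poly_dist n (a i) (f i) (X i ^ a i) < 1"
  shows "regular_sequence (poly_ring n) n f"
proof -
  interpret near_pure_powers n a f using assms by unfold_locales auto
  interpret R: cring "poly_ring n" by (rule cring_poly_ring)
  show ?thesis
    unfolding regular_sequence_def
  proof (intro conjI ballI)
    show "f i \<in> carrier (poly_ring n)" if "i \<in> {1..n}" for i by (rule f_carrier[OF that])
    show "Idl\<^bsub>poly_ring n\<^esub> (f ` {1..n}) \<noteq> carrier (poly_ring n)"
      using one_notin_genideal R.one_closed by (auto simp: poly_ring_simps)
    fix i assume i: "i \<in> {1..n}"
    let ?I = "Idl\<^bsub>poly_ring n\<^esub> (f ` {1..<i})"
    have J: "{1..<i} \<subseteq> {1..n}" using i by auto
    interpret I: ideal ?I "poly_ring n"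
      using J f_carrier by (intro R.genideal_ideal) auto
    show "non_zero_divisor (poly_ring n Quot ?I) (?I +>\<^bsub>poly_ring n\<^esub> f i)"
    proof (rule I.non_zero_divisor_quotI[OF f_carrier[OF i]])
      fix b assume "b \<in> carrier (poly_ring n)" "f i \<otimes>\<^bsub>poly_ring n\<^esub> b \<in> ?I"
      then show "b \<in> ?I"
        using mult_in_genideal_cancel[OF J i] by (simp add: poly_ring_simps)
    qed
  qed
qed

end
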